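(* Let $p$ be an odd prime and $q=p^r$. (i) If $q\equiv 1\pmod 8$, then (with a fixed $\sqrt2\in\mathbb{F}_q$ and signs chosen consistently) \[ {_2}F_1\left(\begin{array}{cc}\chi_4, & \chi_4^3\\ & \varepsilon\end{array}\Big|\left(\frac{-2\sqrt{2}\pm3}{6\sqrt{2}\pm3}\right)^2\right)_q=\varphi(6\pm12\sqrt{2})\left\{\binom{\chi_4}{\varphi}+\binom{\chi_4^3}{\varphi}\right\}. \] (ii) If $q\equiv 1\pmod{12}$, then (with a fixed $\sqrt3\in\mathbb{F}_q$) \[ {_2}F_1\left(\begin{array}{cc}\chi_4, & \chi_4^3\\ & \varepsilon\end{array}\Big|\left(\frac{-2\pm\sqrt{3}}{6\pm\sqrt{3}}\right)^2\right)_q=\varphi\!\left(\frac{8\pm5\sqrt{3}}{12\pm6\sqrt{3}}\right)\left\{\binom{\varphi}{\chi_3}+\binom{\varphi}{\chi_3^2}\right\}. \]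
   Context: Multiplicative characters of $\mathbb{F}_q^\times$ (including the trivial $\varepsilon$) are extended by $\chi(0)=0$; $\varphi$ is the quadratic character, $\chi_4$ a character of order $4$, $\chi_3$ a character of order $3$. Greene's binomial coefficient $\binom{A}{B}:=\frac{B(-1)}{q}\sum_{y\in\mathbb{F}_q}A(y)\overline{B}(1-y)$ and Greene's function ${_2}F_1\left(\begin{array}{cc}A_0, & A_1\\ & B_1\end{array}|x\right)_q:=\frac{q}{q-1}\sum_{\chi}\binom{A_0\chi}{\chi}\binom{A_1\chi}{B_1\chi}\chi(x)$, summing over all multiplicative characters $\chi$. *)

theory Defs
  imports Complex_Main "HOL-Library.Cardinality" "HOL-Library.FuncSet" "HOL-Number_Theory.Cong"
begin

text \<open>
  A multiplicative character is represented by its extension by zero to the whole field, so that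
  a product of characters is the pointwise product and the inverse of a character is its complex
  conjugate.
\<close>

definition mult_char :: "('a::field \<Rightarrow> complex) \<Rightarrow> bool" where
  "mult_char \<chi> \<longleftrightarrow> \<chi> 0 = 0 \<and> \<chi> 1 = 1 \<and> (\<forall>x y. \<chi> (x * y) = \<chi> x * \<chi> y)"

definition trivial_char :: "'a::field \<Rightarrow> complex" where
  "trivial_char x = (if x = 0 then 0 else 1)"

definition quadratic_char :: "'a::field \<Rightarrow> complex" where
  "quadratic_char x = (if x = 0 then 0 else if (\<exists>y. x = y\<^sup>2) then 1 else - 1)"

definition char_order :: "('a::field \<Rightarrow> complex) \<Rightarrow> nat" where
  "char_order \<chi> = (LEAST n. 0 < n \<and> (\<lambda>x. \<chi> x ^ n) = trivial_char)"

definition char_binomial :: "('a::{field,finite} \<Rightarrow> complex) \<Rightarrow> ('a \<Rightarrow> complex) \<Rightarrow> complex" where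
  "char_binomial A B = B (- 1) / of_nat CARD('a) * (\<Sum>y\<in>UNIV. A y * cnj (B (1 - y)))"

definition greene_2F1 ::
  "('a::{field,finite} \<Rightarrow> complex) \<Rightarrow> ('a \<Rightarrow> complex) \<Rightarrow> ('a \<Rightarrow> complex) \<Rightarrow> 'a \<Rightarrow> complex" where
  "greene_2F1 A\<^sub>0 A\<^sub>1 B\<^sub>1 x =
     of_nat CARD('a) / (of_nat CARD('a) - 1) *
     (\<Sum>\<chi> | mult_char \<chi>.
        char_binomial (\<lambda>y. A\<^sub>0 y * \<chi> y) \<chi> *
        char_binomial (\<lambda>y. A\<^sub>1 y * \<chi> y) (\<lambda>y. B\<^sub>1 y * \<chi> y) * \<chi> x)"

text \<open>The index set of the sum above is finite, so the sum is not zero by convention.\<close>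

lemma finite_mult_chars: "finite {\<chi> :: 'a::{field,finite} \<Rightarrow> complex. mult_char \<chi>}"
proof -
  define S where "S = {y::'a. y \<noteq> 0}"
  define n where "n = card S"
  have "1 \<in> S" by (simp add: S_def)
  then have n: "n > 0" by (auto simp: n_def card_gt_0_iff)
  have pw: "x ^ n = 1" if "x \<noteq> 0" for x :: 'a
  proof -
    have "bij_betw ((*) x) S S"
      by (rule bij_betwI[where g = "\<lambda>y. y / x"]) (use that in \<open>auto simp: S_def\<close>)
    then have "(\<Prod>y\<in>S. x * y) = \<Prod>S"
      by (rule prod.reindex_bij_betw)
    then have "x ^ n * \<Prod>S = \<Prod>S" by (simp add: prod.distrib n_def)
    moreover have "\<Prod>S \<noteq> 0" by (simp add: S_def)
    ultimately show ?thesis by simp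
  qed
  have chpow: "\<chi> (x ^ k) = \<chi> x ^ k" if "mult_char \<chi>" for \<chi> and x :: 'a and k
    using that by (induction k) (auto simp: mult_char_def)
  let ?T = "insert 0 {z::complex. z ^ n = 1}"
  have "finite ?T" using finite_roots_unity[of n] n by simp
  then have fin: "finite (Pi\<^sub>E (UNIV :: 'a set) (\<lambda>_. ?T))"
    by (intro finite_PiE) auto
  have "{\<chi> :: 'a \<Rightarrow> complex. mult_char \<chi>} \<subseteq> Pi\<^sub>E UNIV (\<lambda>_. ?T)"
  proof
    fix \<chi> :: "'a \<Rightarrow> complex" assume "\<chi> \<in> {\<chi>. mult_char \<chi>}"
    then have c: "mult_char \<chi>" by simp
    have "\<chi> x \<in> ?T" for x
      using c chpow[OF c, of x n] pw[of x] by (cases "x = 0") (auto simp: mult_char_def)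
    then show "\<chi> \<in> Pi\<^sub>E UNIV (\<lambda>_. ?T)" by auto
  qed
  then show ?thesis using fin finite_subset by blast
qed

end

theory Submission
  imports Defs "HOL-Algebra.Multiplicative_Group"
begin

text \<open>
  Orthogonality of characters turns Greene's series into the sum of \<open>\<chi>\<^sub>4 (y (1 - y + x y) / (1 - y))\<close>
  over \<open>y\<close>.  Counting the solutions \<open>y\<close> of \<open>y (1 - y + x y) / (1 - y) = t\<close>, using the symmetry
  \<open>t \<mapsto> 1 / t\<close> to see that only squares \<open>t = v\<^sup>2\<close> contribute, and passing to \<open>v + 1 / v\<close> yields for
  \<open>x = z\<^sup>2\<close> the quadratic character sum of the elliptic curve \<open>y\<^sup>2 = w (w\<^sup>2 - 4 w + 4 z\<^sup>2)\<close>, which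
  is 2-isogenous to a twist of \<open>y\<^sup>2 = w (w + 1 - z) (w + 1 + z)\<close>.  At the two special arguments
  a further 2-isogeny, at another point of order 2, leads to twists of \<open>y\<^sup>2 = v\<^sup>3 - v\<close> and
  \<open>y\<^sup>2 = v\<^sup>3 - 1\<close>, whose character sums are the Jacobi sums on the right-hand sides.
\<close>

section \<open>Multiplicative characters of a finite field\<close>

text \<open>The field is repackaged as the record \<open>R\<close> so that the HOL-Algebra theorem
  on cyclic unit groups applies. The third property says that the generator has order exactly
  \<open>CARD('a) - 1\<close>.\<close>

lemma finite_field_generator:
  obtains g :: "'a::{field,finite}"
  where "g \<noteq> 0" "\<And>x. x \<noteq> 0 \<Longrightarrow> \<exists>k. x = g ^ k"
    "\<And>i j. g ^ i = g ^ j \<longleftrightarrow> [i = j] (mod (CARD('a) - 1))"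
proof -
  define R :: "'a ring"
    where "R = \<lparr>carrier = UNIV, monoid.mult = (*), one = 1, ring.zero = 0, add = (+)\<rparr>"
  have "\<exists>y. x + y = 0" for x :: 'a by (rule exI[of _ "- x"]) simp
  moreover have "\<exists>y. x * y = 1" if "x \<noteq> 0" for x :: 'a
    by (rule exI[of _ "inverse x"]) (use that in simp)
  ultimately interpret field R
    by unfold_locales (auto simp: R_def Units_def algebra_simps)
  interpret G: group "mult_of R" by (rule field_mult_group)
  have cm: "carrier (mult_of R) = UNIV - {0}" by (simp add: R_def)
  have powR: "x [^]\<^bsub>R\<^esub> (i::nat) = x ^ i" for x i
    by (induction i) (simp_all add: nat_pow_def R_def power_commutes)
  have pow: "x [^]\<^bsub>mult_of R\<^esub> (i::nat) = x ^ i" for x i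
    by (simp add: nat_pow_mult_of powR)
  have "finite (carrier R)" by simp
  from finite_field_mult_group_has_gen[OF this]
  obtain g where g: "g \<in> carrier (mult_of R)"
    "carrier (mult_of R) = {g [^]\<^bsub>R\<^esub> i | i::nat. i \<in> UNIV}"
    by (rule bexE)
  have "finite (carrier (mult_of R))" by (simp only: cm) simp
  then have "generate (mult_of R) {g} = carrier (mult_of R)"
    using G.generate_pow_on_finite_carrier[OF _ g(1)] g(2) unfolding nat_pow_mult_of by metis
  then have "G.ord g = card (carrier (mult_of R))"
    using G.generate_pow_card[OF g(1)] by metis
  then have o: "G.ord g = CARD('a) - 1"
    by (simp only: cm) (simp add: card_Diff_subset)
  show thesis
  proof
    show "g \<noteq> 0" using g(1) by (simp only: cm) simp
    show "\<exists>k. x = g ^ k" if "x \<noteq> 0" for x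
      using g(2) that unfolding cm powR by auto
    show "g ^ i = g ^ j \<longleftrightarrow> [i = j] (mod (CARD('a) - 1))" for i j
      using G.int_pow_eq[OF g(1), of "int i" "int j"] unfolding o
      by (simp add: pow int_pow_int flip: cong_int_iff cong_iff_dvd_diff) (metis cong_sym cong_iff_dvd_diff)
  qed
qed

lemma power_card_minus_1: "x ^ (CARD('a) - 1) = 1" if "x \<noteq> 0" for x :: "'a::{field,finite}"
proof -
  obtain g :: 'a where g: "\<And>x. x \<noteq> 0 \<Longrightarrow> \<exists>k. x = g ^ k"
    "\<And>i j. g ^ i = g ^ j \<longleftrightarrow> [i = j] (mod (CARD('a) - 1))"
    using finite_field_generator by metis
  obtain k where "x = g ^ k" using g(1) \<open>x \<noteq> 0\<close> by blast
  then have "x ^ (CARD('a) - 1) = g ^ (k * (CARD('a) - 1))" by (simp add: power_mult)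
  also have "\<dots> = g ^ 0" by (subst g(2)) (simp add: cong_def)
  finally show ?thesis by simp
qed

lemma card_field_gt_1: "CARD('a::{field,finite}) > 1"
  using card_mono[of "UNIV :: 'a set" "{0,1}"] by simp

text \<open>Translation by 1 permutes the field, so the sum of all elements does not change when
  \<open>CARD('a)\<close> ones are added to it. This is how small characteristics are excluded
  later.\<close>

lemma of_nat_CARD: "of_nat (CARD('a)) = (0 :: 'a::{field,finite})"
proof -
  have "(\<Sum>x::'a\<in>UNIV. x) = (\<Sum>x\<in>UNIV. x + 1)"
    by (rule sum.reindex_bij_witness[of _ "\<lambda>x. x + 1" "\<lambda>x. x - 1"]) auto
  then show ?thesis by (simp add: sum.distrib)
qed

lemma mult_charD:
  assumes "mult_char \<chi>"
  shows "\<chi> 0 = 0" "\<chi> 1 = 1" "\<chi> (x * y) = \<chi> x * \<chi> y" "\<chi> (x ^ n) = \<chi> x ^ n"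
    "x \<noteq> 0 \<Longrightarrow> \<chi> x \<noteq> 0" "\<chi> (inverse x) = inverse (\<chi> x)" "\<chi> (x / y) = \<chi> x / \<chi> y"
proof -
  show *: "\<chi> 0 = 0" "\<chi> 1 = 1" "\<chi> (x * y) = \<chi> x * \<chi> y" for x y
    using assms by (auto simp: mult_char_def)
  show "\<chi> (x ^ n) = \<chi> x ^ n" by (induction n) (simp_all add: *)
  show "\<chi> x \<noteq> 0" if "x \<noteq> 0" using *(2) *(3)[of x "inverse x"] that by auto
  show **: "\<chi> (inverse x) = inverse (\<chi> x)" for x
    using *(1,2) *(3)[of x "inverse x"] by (cases "x = 0") (auto simp: inverse_unique)
  show "\<chi> (x / y) = \<chi> x / \<chi> y" by (simp add: divide_inverse * **)
qed

lemma mult_char_eq_0_iff: "mult_char \<chi> \<Longrightarrow> \<chi> x = 0 \<longleftrightarrow> x = 0"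
  using mult_charD by blast

lemma mult_char_power_card:
  fixes \<chi> :: "'a::{field,finite} \<Rightarrow> complex"
  assumes "mult_char \<chi>" "x \<noteq> 0"
  shows "\<chi> x ^ (CARD('a) - 1) = 1"
  by (metis assms mult_charD(2,4) power_card_minus_1)

text \<open>Nonzero values are roots of unity, hence of norm 1, and for those conjugation is
  inversion; at 0 both sides vanish because \<open>inverse 0 = 0\<close>.\<close>

lemma cnj_mult_char:
  fixes \<chi> :: "'a::{field,finite} \<Rightarrow> complex"
  assumes "mult_char \<chi>"
  shows "cnj (\<chi> x) = \<chi> (inverse x)"
proof (cases "x = 0")
  case False
  then have "norm (\<chi> x) = 1"
    using power_eq_1_iff[OF mult_char_power_card[OF assms]] card_field_gt_1[where 'a='a] by simp
  then show ?thesis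
    using mult_charD(6)[OF assms] complex_div_cnj[of 1 "\<chi> x"] by (simp add: inverse_eq_divide)
qed (use assms in \<open>simp add: mult_charD\<close>)

lemma mult_char_mult: "mult_char \<chi> \<Longrightarrow> mult_char \<psi> \<Longrightarrow> mult_char (\<lambda>x. \<chi> x * \<psi> x)"
  by (simp add: mult_char_def)

lemma mult_char_pow: "mult_char \<chi> \<Longrightarrow> n > 0 \<Longrightarrow> mult_char (\<lambda>x. \<chi> x ^ n)"
  by (simp add: mult_char_def power_mult_distrib)

lemma mult_char_cnj: "mult_char \<chi> \<Longrightarrow> mult_char (\<lambda>x. cnj (\<chi> x))"
  by (simp add: mult_char_def)

lemma mult_char_trivial: "mult_char trivial_char"
  by (simp add: mult_char_def trivial_char_def)

section \<open>Orthogonality of characters\<close>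

lemma sum_scale:
  fixes c :: "'a::{field,finite}"
  assumes "c \<noteq> 0"
  shows "(\<Sum>x\<in>UNIV. f (c * x)) = (\<Sum>x\<in>UNIV. f x)"
  by (rule sum.reindex_bij_witness[of _ "\<lambda>x. x / c" "\<lambda>x. c * x"]) (use assms in auto)

lemma sum_shift: "(\<Sum>x\<in>UNIV. f (x + c)) = (\<Sum>x\<in>UNIV. f x)" for c :: "'a::{field,finite}"
  by (rule sum.reindex_bij_witness[of _ "\<lambda>x. x - c" "\<lambda>x. x + c"]) auto

lemma sum_mult_char:
  fixes \<chi> :: "'a::{field,finite} \<Rightarrow> complex"
  assumes "mult_char \<chi>"
  shows "(\<Sum>x\<in>UNIV. \<chi> x) = (if \<chi> = trivial_char then of_nat CARD('a) - 1 else 0)"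
proof (cases "\<chi> = trivial_char")
  case True
  have "(\<Sum>x::'a\<in>UNIV. trivial_char x) = (\<Sum>x::'a\<in>UNIV - {0}. 1)"
    by (rule sum.mono_neutral_cong_right) (auto simp: trivial_char_def)
  then show ?thesis
    using True card_field_gt_1[where 'a='a] by (simp add: card_Diff_subset of_nat_diff)
next
  case False
  then obtain a where a: "\<chi> a \<noteq> trivial_char a" by (auto simp: fun_eq_iff)
  with assms have "a \<noteq> 0" by (auto simp: mult_charD trivial_char_def)
  then have "\<chi> a * (\<Sum>x\<in>UNIV. \<chi> x) = (\<Sum>x\<in>UNIV. \<chi> x)"
    using sum_scale[of a \<chi>] assms by (simp add: mult_charD sum_distrib_left)
  then show ?thesis using a False \<open>a \<noteq> 0\<close> by (simp add: trivial_char_def)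
qed

text \<open>A generator is sent to a primitive root of unity of order \<open>CARD('a) - 1\<close>.
  Orthogonality in the variable \<chi> needs such a character, to separate any element from
  1.\<close>

lemma faithful_mult_char:
  obtains \<psi> :: "'a::{field,finite} \<Rightarrow> complex"
  where "mult_char \<psi>" "\<And>x. \<psi> x = 1 \<Longrightarrow> x = 1"
proof -
  obtain g :: 'a where g: "g \<noteq> 0" "\<And>x. x \<noteq> 0 \<Longrightarrow> \<exists>k. x = g ^ k"
    "\<And>i j. g ^ i = g ^ j \<longleftrightarrow> [i = j] (mod (CARD('a) - 1))"
    using finite_field_generator by metis
  define M where "M = CARD('a) - 1"
  define \<zeta> where "\<zeta> = cis (2 * pi / real M)"
  have M: "M > 0" using card_field_gt_1[where 'a='a] by (simp add: M_def)
  have \<zeta>: "\<zeta> ^ i = \<zeta> ^ j \<longleftrightarrow> [i = j] (mod M)" for i j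
  proof -
    have *: "\<zeta> ^ i = \<zeta> ^ (i mod M)" for i
    proof -
      have "\<zeta> ^ M = 1" using M by (simp add: \<zeta>_def DeMoivre)
      then have "\<zeta> ^ (i mod M + M * (i div M)) = \<zeta> ^ (i mod M)"
        by (simp only: power_add power_mult) simp
      then show ?thesis by simp
    qed
    have "inj_on (\<lambda>k. \<zeta> ^ k) {..<M}"
      using bij_betw_imp_inj_on[OF bij_betw_roots_unity[OF M]] by (simp add: \<zeta>_def DeMoivre mult_ac)
    then show ?thesis
      using M *[of i] *[of j] by (auto simp: cong_def inj_on_def)
  qed
  \<comment> \<open>A discrete logarithm is determined only modulo \<open>M\<close>; the choice is
    harmless because powers of \<zeta> coincide exactly when the exponents agree modulo
    \<open>M\<close>.\<close>
  define ind where "ind x = (SOME k. x = g ^ k)" for x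
  have ind: "g ^ ind x = x" if "x \<noteq> 0" for x
    using someI_ex[OF g(2)[OF that]] by (simp add: ind_def)
  define \<psi> where "\<psi> x = (if x = 0 then 0 else \<zeta> ^ ind x)" for x
  have \<psi>: "\<psi> (g ^ k) = \<zeta> ^ k" for k
    using g ind[of "g ^ k"] by (simp add: \<psi>_def \<zeta> M_def)
  have "\<psi> (x * y) = \<psi> x * \<psi> y" for x y
  proof (cases "x = 0 \<or> y = 0")
    case False
    then obtain i j where "x = g ^ i" "y = g ^ j" using g(2) by metis
    then show ?thesis using \<psi>[of "i + j"] by (simp add: \<psi> power_add)
  qed (auto simp: \<psi>_def)
  then have "mult_char \<psi>"
    using \<psi>[of 0] by (auto simp: mult_char_def) (simp add: \<psi>_def)
  moreover have "x = 1" if "\<psi> x = 1" for x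
  proof -
    have "x \<noteq> 0" using that by (auto simp: \<psi>_def)
    then obtain k where k: "x = g ^ k" using g(2) by blast
    then have "\<zeta> ^ k = \<zeta> ^ 0" using that \<psi> by simp
    then show ?thesis using k g(3)[of k 0] \<zeta>[of k 0] by (simp add: M_def)
  qed
  ultimately show thesis using that by blast
qed

lemma sum_over_mult_chars:
  fixes a :: "'a::{field,finite}"
  shows "(\<Sum>\<chi> | mult_char \<chi>. \<chi> a) = (if a = 1 then of_nat CARD('a) - 1 else 0)"
proof -
  define Z where "Z a = (\<Sum>\<chi> | mult_char \<chi>. \<chi> a)" for a :: 'a
  obtain \<psi> :: "'a \<Rightarrow> complex" where \<psi>: "mult_char \<psi>" "\<And>x. \<psi> x = 1 \<Longrightarrow> x = 1"
    using faithful_mult_char by metis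
  have Z0: "Z a = 0" if "a \<noteq> 1" for a
  proof (cases "a = 0")
    case True
    then show ?thesis by (simp add: Z_def mult_charD)
  next
    case False
    have inv: "\<psi> y * cnj (\<psi> y) * \<chi> y = \<chi> y" if "mult_char \<chi>" for \<chi> y
      using that \<psi>(1) mult_char_eq_0_iff[OF \<psi>(1)]
      by (cases "y = 0") (simp_all add: mult_charD cnj_mult_char)
    \<comment> \<open>Multiplication by \<psi> permutes the characters, with multiplication by its
      conjugate as inverse. Since \<open>\<psi> a\<close> differs from 1, the sum must
      vanish.\<close>
    have "Z a = (\<Sum>\<chi> | mult_char \<chi>. \<psi> a * \<chi> a)"
      unfolding Z_def
      by (rule sum.reindex_bij_witness[of _ "\<lambda>\<chi> x. \<psi> x * \<chi> x" "\<lambda>\<chi> x. cnj (\<psi> x) * \<chi> x"])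
        (use \<psi>(1) inv in \<open>auto simp: mult_char_mult mult_char_cnj ac_simps fun_eq_iff\<close>)
    also have "\<dots> = \<psi> a * Z a" by (simp add: Z_def sum_distrib_left)
    finally show ?thesis using \<psi>(2) that by force
  qed
  \<comment> \<open>\<open>Z 1\<close> is the number of characters. It is found by summing
    \<open>Z\<close> over the field and exchanging the sums: only the trivial character then
    contributes.\<close>
  have "Z 1 = (\<Sum>a\<in>UNIV. Z a)"
    using Z0 by (simp add: sum.remove[of UNIV 1 Z])
  also have "\<dots> = (\<Sum>\<chi> | mult_char \<chi>. \<Sum>a::'a\<in>UNIV. \<chi> a)"
    unfolding Z_def by (rule sum.swap)
  also have "\<dots> = (\<Sum>\<chi> | mult_char \<chi>. if \<chi> = (trivial_char :: 'a \<Rightarrow> complex) then of_nat CARD('a) - 1 else 0)"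
    by (rule sum.cong) (simp_all add: sum_mult_char)
  also have "\<dots> = of_nat CARD('a) - 1"
    by (subst sum.delta) (simp_all add: finite_mult_chars mult_char_trivial)
  finally show ?thesis using Z0 by (auto simp: Z_def)
qed

section \<open>Orders of characters and counting n-th roots\<close>

lemma char_order_properties:
  fixes \<chi> :: "'a::{field,finite} \<Rightarrow> complex"
  assumes "mult_char \<chi>"
  shows "0 < char_order \<chi>" "(\<forall>x. x \<noteq> 0 \<longrightarrow> \<chi> x ^ n = 1) \<longleftrightarrow> char_order \<chi> dvd n"
proof -
  define P where "P n \<longleftrightarrow> 0 < n \<and> (\<forall>x. x \<noteq> 0 \<longrightarrow> \<chi> x ^ n = 1)" for n
  define d where "d = char_order \<chi>"
  \<comment> \<open>At 0 both \<open>\<chi> 0 ^ n\<close> and \<open>trivial_char 0\<close> are 0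
    for positive \<open>n\<close>, so the equation of functions reduces to nonzero
    arguments.\<close>
  have d: "d = (LEAST n. P n)"
    unfolding d_def char_order_def P_def using assms
    by (intro arg_cong[where f = Least])
      (auto simp: fun_eq_iff trivial_char_def mult_charD)
  have "P (CARD('a) - 1)"
    using card_field_gt_1[where 'a='a] mult_char_power_card[OF assms] by (simp add: P_def)
  then have "P d" unfolding d by (rule LeastI)
  then show "0 < char_order \<chi>" by (simp add: P_def d_def)
  have "\<chi> x ^ n = \<chi> x ^ (n mod d)" if "x \<noteq> 0" for x n
  proof -
    have "\<chi> x ^ n = \<chi> x ^ (d * (n div d) + n mod d)" by simp
    also have "\<dots> = \<chi> x ^ (n mod d)"
      using \<open>P d\<close> that by (simp only: power_add power_mult) (simp add: P_def)
    finally show ?thesis .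
  qed
  moreover have "\<not> P (n mod d)"
    using not_less_Least[of "n mod d" P] d \<open>P d\<close> by (simp add: P_def)
  ultimately have "(\<forall>x. x \<noteq> 0 \<longrightarrow> \<chi> x ^ n = 1) \<longleftrightarrow> d dvd n"
    unfolding P_def dvd_eq_mod_eq_0 by (metis bot_nat_0.not_eq_extremum power_0)
  then show "(\<forall>x. x \<noteq> 0 \<longrightarrow> \<chi> x ^ n = 1) \<longleftrightarrow> char_order \<chi> dvd n" by (simp add: d_def)
qed

lemma char_order_dvd_card:
  fixes \<chi> :: "'a::{field,finite} \<Rightarrow> complex"
  assumes "mult_char \<chi>"
  shows "char_order \<chi> dvd CARD('a) - 1"
  using mult_char_power_card[OF assms] char_order_properties(2)[OF assms] by blast

lemma power_char_order:
  fixes \<chi> :: "'a::{field,finite} \<Rightarrow> complex"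
  assumes "mult_char \<chi>" "x \<noteq> 0"
  shows "\<chi> x ^ char_order \<chi> = 1"
  using char_order_properties(2)[OF assms(1), of "char_order \<chi>"] assms(2) by simp

lemma sum_fibre:
  fixes h :: "'b \<Rightarrow> 'c::finite" and f :: "'c \<Rightarrow> complex"
  assumes "finite S"
  shows "(\<Sum>x\<in>S. f (h x)) = (\<Sum>t\<in>UNIV. f t * of_nat (card {x\<in>S. h x = t}))"
proof -
  have "(\<Sum>x\<in>S. f (h x)) = (\<Sum>x\<in>S. \<Sum>t\<in>UNIV. if h x = t then f t else 0)"
    by simp
  also have "\<dots> = (\<Sum>t\<in>UNIV. \<Sum>x\<in>S. if h x = t then f t else 0)"
    by (rule sum.swap)
  also have "\<dots> = (\<Sum>t\<in>UNIV. f t * of_nat (card {x\<in>S. h x = t}))"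
    by (rule sum.cong) (simp_all add: assms mult.commute flip: sum.inter_filter)
  finally show ?thesis .
qed

text \<open>If \<open>\<chi> t\<close> is not 1, there is no root and the geometric sum vanishes.
  Otherwise all fibres of the n-th power map over the kernel \<open>K\<close> of \<chi> have the
  same size; the partition of the nonzero elements into these fibres, compared with
  \<open>n * card K = CARD('a) - 1\<close>, shows that this size is \<open>n\<close>.\<close>

lemma card_power_eq:
  fixes \<chi> :: "'a::{field,finite} \<Rightarrow> complex"
  assumes \<chi>: "mult_char \<chi>" and n: "char_order \<chi> = n" and "t \<noteq> 0"
  shows "of_nat (card {x. x ^ n = t}) = (\<Sum>k<n. \<chi> t ^ k)"
proof (cases "\<chi> t = 1")
  case False
  have n0: "n > 0" using char_order_properties(1)[OF \<chi>] n by simp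
  have "x ^ n \<noteq> t" for x
  proof
    assume *: "x ^ n = t"
    then have "x \<noteq> 0" using \<open>t \<noteq> 0\<close> n0 by (auto simp: power_0_left)
    then show False using * False mult_charD(4)[OF \<chi>, of x n] power_char_order[OF \<chi>] n by simp
  qed
  moreover have "(\<Sum>k<n. \<chi> t ^ k) = 0"
    using False power_char_order[OF \<chi> \<open>t \<noteq> 0\<close>] n by (simp add: geometric_sum)
  ultimately show ?thesis by simp
next
  case True
  have n0: "n > 0" using char_order_properties(1)[OF \<chi>] n by simp
  obtain g :: 'a where g: "g \<noteq> 0" "\<And>x. x \<noteq> 0 \<Longrightarrow> \<exists>k. x = g ^ k"
    using finite_field_generator by metis
  have fibre: "card {x. x ^ n = u} = card {x::'a. x ^ n = 1}" if "u \<noteq> 0" "\<chi> u = 1" for u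
  proof -
    obtain j where j: "u = g ^ j" using g(2) \<open>u \<noteq> 0\<close> by blast
    \<comment> \<open>For x = g^i the value is \<open>\<chi> u ^ i\<close>. So the j-th power of
      \<chi> is trivial, \<open>n\<close> divides \<open>j\<close>, and \<open>u\<close> is itself
      an n-th power.\<close>
    have "\<chi> x ^ j = 1" if "x \<noteq> 0" for x
    proof -
      obtain i where "x = g ^ i" using g(2) \<open>x \<noteq> 0\<close> by blast
      then have "\<chi> x ^ j = \<chi> u ^ i" using j by (simp add: mult_charD[OF \<chi>] mult.commute flip: power_mult)
      then show ?thesis using \<open>\<chi> u = 1\<close> by simp
    qed
    then have "n dvd j" using char_order_properties(2)[OF \<chi>, of j] n by blast
    then obtain m where "u = (g ^ m) ^ n" using j by (metis dvdE mult.commute power_mult)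
    then obtain c where c: "c \<noteq> 0" "u = c ^ n" using g(1) by (metis power_not_zero)
    show ?thesis
      by (rule bij_betw_same_card, rule bij_betwI[where f = "\<lambda>x. x / c" and g = "\<lambda>x. c * x"])
        (use c in \<open>auto simp: power_divide power_mult_distrib\<close>)
  qed
  define K where "K = {u. u \<noteq> 0 \<and> \<chi> u = 1}"
  have "\<chi> (x ^ n) = 1" if "x \<noteq> 0" for x
    using power_char_order[OF \<chi> that] n by (simp add: mult_charD[OF \<chi>])
  then have "UNIV - {0} = (\<Union>u\<in>K. {x. x ^ n = u})"
    using n0 by (auto simp: K_def power_0_left) blast
  then have "card (UNIV - {0::'a}) = card (\<Union>u\<in>K. {x. x ^ n = u})" by simp
  also have "\<dots> = (\<Sum>u\<in>K. card {x. x ^ n = u})"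
    by (rule card_UN_disjoint) auto
  also have "\<dots> = card K * card {x::'a. x ^ n = 1}"
    using fibre by (simp add: K_def)
  finally have c1: "CARD('a) - 1 = card K * card {x::'a. x ^ n = 1}" by (simp add: card_Diff_subset)
  \<comment> \<open>This double sum is evaluated twice: summing over \<open>k\<close> first gives
    \<open>n\<close> for each element of \<open>K\<close>, summing over \<open>u\<close> first
    leaves only \<open>k = 0\<close>.\<close>
  have "(\<Sum>u\<in>UNIV-{0}. \<Sum>k<n. \<chi> u ^ k) = (\<Sum>u\<in>UNIV-{0}. if u \<in> K then of_nat n else 0)"
    using power_char_order[OF \<chi>] n by (intro sum.cong) (auto simp: K_def geometric_sum)
  also have "\<dots> = of_nat (n * card K)"
    by (subst sum.inter_restrict[symmetric]) (simp_all add: K_def Int_def)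
  finally have "of_nat (n * card K) = (\<Sum>k<n. \<Sum>u\<in>UNIV-{0}. \<chi> u ^ k)"
    by (subst sum.swap) simp
  also have "\<dots> = (\<Sum>k<n. if k = 0 then of_nat (CARD('a) - 1) else 0)"
  proof (rule sum.cong)
    fix k assume "k \<in> {..<n}"
    show "(\<Sum>u\<in>UNIV-{0}. \<chi> u ^ k) = (if k = 0 then of_nat (CARD('a) - 1) else 0)"
    proof (cases "k = 0")
      case True
      then show ?thesis by (simp add: card_Diff_subset)
    next
      case False
      then have "\<not> n dvd k" using \<open>k \<in> {..<n}\<close> by (auto dest: dvd_imp_le)
      then obtain x where "x \<noteq> 0" "\<chi> x ^ k \<noteq> 1" using char_order_properties(2)[OF \<chi>] n by metis
      then have "(\<lambda>x. \<chi> x ^ k) \<noteq> trivial_char" by (auto simp: fun_eq_iff trivial_char_def)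
      then have "(\<Sum>u\<in>UNIV. \<chi> u ^ k) = 0" using False \<chi> by (simp add: sum_mult_char mult_char_pow)
      then show ?thesis using False \<chi> by (simp add: sum_diff1 mult_charD)
    qed
  qed simp
  also have "\<dots> = of_nat (CARD('a) - 1)" using n0 by simp
  finally have "n * card K = CARD('a) - 1" by (simp only: of_nat_eq_iff)
  moreover have "card K \<noteq> 0" using \<open>t \<noteq> 0\<close> True by (auto simp: K_def)
  ultimately have "card {x::'a. x ^ n = 1} = n" using c1 by simp
  then show ?thesis using True fibre[OF \<open>t \<noteq> 0\<close>] by simp
qed

lemma sum_over_powers:
  fixes \<chi> :: "'a::{field,finite} \<Rightarrow> complex"
  assumes "mult_char \<chi>" "char_order \<chi> = n" "f 0 = 0"
  shows "(\<Sum>x\<in>UNIV. f (x ^ n)) = (\<Sum>t\<in>UNIV. f t * (\<Sum>k<n. \<chi> t ^ k))"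
proof -
  have "(\<Sum>x\<in>UNIV. f (x ^ n)) = (\<Sum>t\<in>UNIV. f t * of_nat (card {x. x ^ n = t}))"
    using sum_fibre[of UNIV f "\<lambda>x. x ^ n"] by simp
  also have "\<dots> = (\<Sum>t\<in>UNIV. f t * (\<Sum>k<n. \<chi> t ^ k))"
  proof (rule sum.cong)
    show "f t * of_nat (card {x. x ^ n = t}) = f t * (\<Sum>k<n. \<chi> t ^ k)" for t
      using assms card_power_eq[OF assms(1,2), of t] by (cases "t = 0") simp_all
  qed simp
  finally show ?thesis .
qed

text \<open>The number of square roots of a nonzero \<open>t\<close> is \<open>1 + \<chi> t\<close>,
  so \<open>\<chi> t\<close> is 1 or -1 according to whether \<open>t\<close> is a square.\<close>

lemma quadratic_char_unique:
  fixes \<chi> :: "'a::{field,finite} \<Rightarrow> complex"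
  assumes "mult_char \<chi>" "char_order \<chi> = 2"
  shows "\<chi> = quadratic_char"
proof
  fix t
  show "\<chi> t = quadratic_char t"
  proof (cases "t = 0")
    case False
    have card: "of_nat (card {x. x\<^sup>2 = t}) = 1 + \<chi> t"
      using card_power_eq[OF assms False] by (simp add: numeral_2_eq_2)
    have "\<chi> t ^ 2 = 1" using power_char_order[OF assms(1) False] assms(2) by simp
    then have "\<chi> t = 1 \<or> \<chi> t = -1" by (simp add: power2_eq_1_iff)
    then show ?thesis
    proof
      assume 1: "\<chi> t = 1"
      then have "{x. x\<^sup>2 = t} \<noteq> {}" using card by (intro notI) simp
      then show ?thesis using 1 False by (auto simp: quadratic_char_def)
    next
      assume *: "\<chi> t = -1"
      then have "{x. x\<^sup>2 = t} = {}" using card by simp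
      then show ?thesis using * False by (auto simp: quadratic_char_def)
    qed
  qed (use assms in \<open>simp add: quadratic_char_def mult_charD\<close>)
qed

section \<open>Greene's function as a character sum\<close>

text \<open>After both binomials are expanded, the factors \<open>\<chi> (-1)\<close> cancel and
  \<chi> is evaluated at the single argument \<open>r y w\<close>. Orthogonality keeps the pairs
  with \<open>r y w = 1\<close>, a linear equation for \<open>w\<close> once \<open>y\<close> is
  fixed.\<close>

lemma greene_2F1_eq_sum:
  fixes A B :: "'a::{field,finite} \<Rightarrow> complex"
  assumes A: "mult_char A" and B: "mult_char B" and "x \<noteq> 0"
  shows "greene_2F1 A B trivial_char x =
    (\<Sum>y\<in>UNIV. A y * B ((1 - y) / (1 - y + x * y))) / of_nat CARD('a)"
proof -
  define q :: complex where "q = of_nat CARD('a)"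
  have q: "q \<noteq> 0" "q \<noteq> 1" using card_field_gt_1[where 'a='a] by (auto simp: q_def)
  \<comment> \<open>Division by 0 yields 0, so \<open>r y w = 0\<close> when \<open>y\<close> or
    \<open>w\<close> is 1, in agreement with the vanishing of \<open>\<chi> (1 - y)\<close> or
    \<open>\<chi> (1 - w)\<close>.\<close>
  define r where "r y w = y * w * x / ((1 - y) * (1 - w))" for y w :: 'a
  have summand: "char_binomial (\<lambda>y. A y * \<chi> y) \<chi> *
      char_binomial (\<lambda>y. B y * \<chi> y) (\<lambda>y. trivial_char y * \<chi> y) * \<chi> x =
      (\<Sum>y\<in>UNIV. \<Sum>w\<in>UNIV. A y * B w * \<chi> (r y w)) / q\<^sup>2" if \<chi>: "mult_char \<chi>" for \<chi>
  proof -
    have t: "trivial_char y * \<chi> y = \<chi> y" for y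
      using \<chi> by (simp add: trivial_char_def mult_charD)
    have "\<chi> (-1) * \<chi> (-1) = 1"
      using mult_charD(3)[OF \<chi>, of "-1" "-1"] mult_charD(2)[OF \<chi>] by simp
    then have "char_binomial (\<lambda>y. A y * \<chi> y) \<chi> *
      char_binomial (\<lambda>y. B y * \<chi> y) \<chi> * \<chi> x =
      (\<Sum>y\<in>UNIV. A y * \<chi> y * cnj (\<chi> (1 - y))) * (\<Sum>w\<in>UNIV. B w * \<chi> w * cnj (\<chi> (1 - w))) * \<chi> x / q\<^sup>2"
      by (simp add: char_binomial_def q_def power2_eq_square field_simps)
    also have "\<dots> = (\<Sum>y\<in>UNIV. \<Sum>w\<in>UNIV. A y * B w * \<chi> (r y w)) / q\<^sup>2"
      unfolding sum_product unfolding sum_distrib_right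
      by (intro arg_cong2[where f = "(/)"] sum.cong refl)
        (simp add: cnj_mult_char[OF \<chi>] r_def mult_charD[OF \<chi>] divide_inverse mult_ac)
    finally show ?thesis by (simp add: t)
  qed
  \<comment> \<open>The case \<open>y = 0\<close> is exceptional: no \<open>w\<close> solves the
    equation although the quotient is 1. It does no harm since \<open>A 0 = 0\<close>. If
    \<open>1 - y + x * y = 0\<close>, there is no solution either, and the quotient takes the
    default value 0, where \<open>B\<close> vanishes.\<close>
  have inner: "(\<Sum>w\<in>UNIV. B w * (if r y w = 1 then 1 else 0)) =
      (if y = 0 then 0 else B ((1 - y) / (1 - y + x * y)))" for y
  proof (cases "y = 0 \<or> y = 1")
    case True
    then show ?thesis by (auto simp: r_def mult_charD[OF B])
  next
    case False
    have r1: "r y w = 1 \<longleftrightarrow> w * (1 - y + x * y) = 1 - y" for w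
    proof (cases "w = 1")
      case True
      then show ?thesis using False \<open>x \<noteq> 0\<close> by (simp add: r_def)
    next
      assume "w \<noteq> 1"
      then have "r y w = 1 \<longleftrightarrow> y * w * x = (1 - y) * (1 - w)"
        using False by (simp add: r_def divide_eq_eq)
      also have "\<dots> \<longleftrightarrow> w * (1 - y + x * y) = 1 - y"
        by (simp add: algebra_simps) algebra
      finally show ?thesis .
    qed
    show ?thesis
    proof (cases "1 - y + x * y = 0")
      case True
      then show ?thesis using False by (simp add: r1 mult_charD[OF B])
    next
      assume "1 - y + x * y \<noteq> 0"
      then have "r y w = 1 \<longleftrightarrow> w = (1 - y) / (1 - y + x * y)" for w
        by (simp add: r1 eq_divide_eq)
      then have "(\<Sum>w\<in>UNIV. B w * (if r y w = 1 then 1 else 0)) =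
          (\<Sum>w\<in>UNIV. if w = (1 - y) / (1 - y + x * y) then B w else 0)"
        by (intro sum.cong) auto
      then show ?thesis using False by simp
    qed
  qed
  have "(\<Sum>\<chi> | mult_char \<chi>. char_binomial (\<lambda>y. A y * \<chi> y) \<chi> *
      char_binomial (\<lambda>y. B y * \<chi> y) (\<lambda>y. trivial_char y * \<chi> y) * \<chi> x) =
      (\<Sum>\<chi> | mult_char \<chi>. (\<Sum>y\<in>UNIV. \<Sum>w\<in>UNIV. A y * B w * \<chi> (r y w)) / q\<^sup>2)"
    by (rule sum.cong) (simp_all add: summand)
  also have "\<dots> = (\<Sum>\<chi> | mult_char \<chi>. \<Sum>y\<in>UNIV. \<Sum>w\<in>UNIV. A y * B w * \<chi> (r y w)) / q\<^sup>2"
    by (rule sum_divide_distrib[symmetric])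
  also have "(\<Sum>\<chi> | mult_char \<chi>. \<Sum>y\<in>UNIV. \<Sum>w\<in>UNIV. A y * B w * \<chi> (r y w)) =
      (\<Sum>y\<in>UNIV. \<Sum>w\<in>UNIV. \<Sum>\<chi> | mult_char \<chi>. A y * B w * \<chi> (r y w))"
    by (subst sum.swap) (intro sum.cong refl sum.swap)
  also have "\<dots> = (\<Sum>y\<in>UNIV. A y * (q - 1) * (\<Sum>w\<in>UNIV. B w * (if r y w = 1 then 1 else 0)))"
    unfolding sum_distrib_left
    by (intro sum.cong refl) (simp add: sum_over_mult_chars q_def flip: sum_distrib_left)
  also have "\<dots> = (q - 1) * (\<Sum>y\<in>UNIV. A y * B ((1 - y) / (1 - y + x * y)))"
    unfolding inner sum_distrib_left by (intro sum.cong refl) (simp add: mult_charD[OF A])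
  finally show ?thesis
    using q by (simp add: greene_2F1_def q_def[symmetric] power2_eq_square field_simps)
qed

section \<open>Character sums in the presence of a quartic character\<close>

locale quartic_char =
  fixes \<chi> :: "'a::{field,finite} \<Rightarrow> complex"
  assumes mult_char: "mult_char \<chi>" and order_4: "char_order \<chi> = 4"
begin

abbreviation \<phi> :: "'a \<Rightarrow> complex" where "\<phi> \<equiv> quadratic_char"

lemma power_4: "x \<noteq> 0 \<Longrightarrow> \<chi> x ^ 4 = 1"
  using power_char_order[OF mult_char] order_4 by simp

lemma order_square: "char_order (\<lambda>x. \<chi> x ^ 2) = 2"
proof -
  have m: "mult_char (\<lambda>x. \<chi> x ^ 2)" using mult_char by (simp add: mult_char_pow)
  have "char_order (\<lambda>x. \<chi> x ^ 2) dvd n \<longleftrightarrow> 2 dvd n" for n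
  proof -
    have "char_order (\<lambda>x. \<chi> x ^ 2) dvd n \<longleftrightarrow> char_order \<chi> dvd 2 * n"
      unfolding char_order_properties(2)[OF m, symmetric] char_order_properties(2)[OF mult_char, symmetric]
      by (simp add: power_mult)
    also have "\<dots> \<longleftrightarrow> 2 * 2 dvd 2 * n" by (simp add: order_4)
    finally show ?thesis by simp
  qed
  then show ?thesis by (metis dvd_antisym dvd_refl)
qed

lemma square_eq: "\<chi> x ^ 2 = \<phi> x"
  using quadratic_char_unique[OF mult_char_pow[OF mult_char] order_square] by (metis zero_less_numeral)

lemma mult_char_quadratic: "mult_char \<phi>"
  using mult_char_pow[OF mult_char, of 2] by (simp add: square_eq)

lemma order_quadratic: "char_order \<phi> = 2"
  using order_square by (simp add: square_eq)

lemmas \<phi>_simps = mult_charD[OF mult_char_quadratic]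

text \<open>A character of order 4 forces \<open>CARD('a)\<close> to have the form 4 m + 1, whose
  image in characteristic 2 would be 1 instead of 0.\<close>

lemma two_neq_0: "(2::'a) \<noteq> 0"
proof
  assume "(2::'a) = 0"
  then have 4: "(4::'a) = 0" by (metis mult_zero_left mult_2_right numeral_Bit0 add.right_neutral)
  have "4 dvd CARD('a) - 1" using char_order_dvd_card[OF mult_char] order_4 by simp
  then obtain m where "CARD('a) = 4 * m + 1"
    using card_field_gt_1[where 'a='a] by (metis dvdE le_add_diff_inverse2 less_imp_le)
  then show False using of_nat_CARD[where 'a='a] 4 by simp
qed

lemma \<phi>_minus_1 [simp]: "\<phi> (-1) = 1"
proof -
  have "\<chi> (-1) ^ 2 = \<chi> 1" using mult_charD(4)[OF mult_char, of "-1" 2, symmetric] by simp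
  then show ?thesis using square_eq mult_charD(2)[OF mult_char] by simp
qed

lemma \<phi>_minus: "\<phi> (- x) = \<phi> x"
  using \<phi>_simps(3)[of "-1" x] by simp

lemma \<phi>_square: "x \<noteq> 0 \<Longrightarrow> \<phi> x * \<phi> x = 1"
  by (simp add: quadratic_char_def)

lemma \<phi>_mult_square: "c \<noteq> 0 \<Longrightarrow> \<phi> (c\<^sup>2 * x) = \<phi> x"
  using \<phi>_square[of c] by (simp add: \<phi>_simps power2_eq_square)

lemma sum_\<phi>: "(\<Sum>x\<in>UNIV. \<phi> x) = 0"
proof -
  have "\<phi> \<noteq> trivial_char"
  proof
    assume "\<phi> = trivial_char"
    then have "\<forall>x. x \<noteq> 0 \<longrightarrow> \<phi> x ^ 1 = 1" by (simp add: trivial_char_def)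
    then have "2 dvd (1::nat)" using char_order_properties(2)[OF mult_char_quadratic, of 1] order_quadratic by metis
    then show False by simp
  qed
  then show ?thesis using sum_mult_char[OF mult_char_quadratic] by simp
qed

section \<open>Substitutions in sums of the quadratic character\<close>

lemma sum_over_squares:
  assumes "f 0 = 0"
  shows "(\<Sum>x\<in>UNIV. f (x\<^sup>2)) = (\<Sum>t\<in>UNIV. f t * (1 + \<phi> t))"
  using sum_over_powers[OF mult_char_quadratic order_quadratic, of f] assms by (simp add: numeral_2_eq_2)

lemma card_quadratic_roots:
  assumes "a \<noteq> 0"
  shows "of_nat (card {y. a * y\<^sup>2 + b * y + c = 0}) = 1 + \<phi> (b\<^sup>2 - 4 * a * c)"
proof -
  let ?D = "b\<^sup>2 - 4 * a * c"
  have 4: "4 * a \<noteq> 0" "2 * a \<noteq> 0" using two_neq_0 assms mult_eq_0_iff[of 2 "2::'a"] by auto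
  have eq: "(2 * a * y + b)\<^sup>2 - ?D = 4 * a * (a * y\<^sup>2 + b * y + c)" for y
    by (simp add: power2_eq_square algebra_simps)
  then have root: "a * y\<^sup>2 + b * y + c = 0 \<longleftrightarrow> (2 * a * y + b)\<^sup>2 = ?D" for y
    using 4 eq[of y] by (metis eq_iff_diff_eq_0 mult_eq_0_iff)
  have "card {y. a * y\<^sup>2 + b * y + c = 0} = card {x. x\<^sup>2 = ?D}"
    unfolding root
    by (rule bij_betw_same_card, rule bij_betwI[where f = "\<lambda>y. 2 * a * y + b" and g = "\<lambda>x. (x - b) / (2 * a)"])
      (use 4 in \<open>auto simp: field_simps\<close>)
  also have "of_nat (card {x. x\<^sup>2 = ?D}) = 1 + \<phi> ?D"
    using card_power_eq[OF mult_char_quadratic order_quadratic, of ?D]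
    by (cases "?D = 0") (simp_all add: numeral_2_eq_2 \<phi>_simps)
  finally show ?thesis .
qed

text \<open>The fibre over \<open>w\<close> is the root set of x^2 - w x + b, of discriminant
  \<open>w\<^sup>2 - 4 * b\<close>. The condition on \<open>b\<close> keeps 0 from being a
  root.\<close>

lemma sum_over_add_div:
  assumes "b \<noteq> 0"
  shows "(\<Sum>x\<in>UNIV - {0}. f (x + b / x)) = (\<Sum>w\<in>UNIV. f w * (1 + \<phi> (w\<^sup>2 - 4 * b)))"
proof -
  have "x + b / x - w = (1 * x\<^sup>2 + (- w) * x + b) / x" if "x \<noteq> 0" for x w
    using that by (simp add: field_simps power2_eq_square)
  then have eq: "x + b / x = w \<longleftrightarrow> 1 * x\<^sup>2 + (- w) * x + b = 0" if "x \<noteq> 0" for x w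
    using that by (metis divide_eq_0_iff eq_iff_diff_eq_0)
  have "{x \<in> UNIV - {0}. x + b / x = w} = {x. 1 * x\<^sup>2 + (- w) * x + b = 0}" for w
  proof (rule Set.set_eqI)
    show "x \<in> {x \<in> UNIV - {0}. x + b / x = w} \<longleftrightarrow> x \<in> {x. 1 * x\<^sup>2 + (- w) * x + b = 0}" for x
      using assms eq[of x w] by (cases "x = 0") simp_all
  qed
  then show ?thesis
    using card_quadratic_roots[of 1 "- w" b for w] sum_fibre[of "UNIV - {0}" f "\<lambda>x. x + b / x"] by simp
qed

text \<open>The curves \<open>y\<^sup>2 = x (x\<^sup>2 + a x + b)\<close> and \<open>y\<^sup>2 = x (x\<^sup>2 - 2 a x + a\<^sup>2 - 4 b)\<close> are 2-isogenous.\<close>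

lemma sum_\<phi>_isogeny:
  assumes "b \<noteq> 0"
  shows "(\<Sum>x\<in>UNIV. \<phi> (x * (x\<^sup>2 + a * x + b))) =
    (\<Sum>x\<in>UNIV. \<phi> (x * (x\<^sup>2 - 2 * a * x + (a\<^sup>2 - 4 * b))))"
proof -
  \<comment> \<open>Translation by the point (0, 0) acts on the first coordinate by x \<mapsto> b /
    x. Up to the square x^2, the cubic is a function of the invariant x + b / x.\<close>
  have "\<phi> (x * (x\<^sup>2 + a * x + b)) = \<phi> (x + b / x + a)" if "x \<noteq> 0" for x
  proof -
    have "x * (x\<^sup>2 + a * x + b) = x\<^sup>2 * (x + b / x + a)"
      using that by (simp add: field_simps power2_eq_square)
    then show ?thesis using \<phi>_mult_square[OF that] by simp
  qed
  then have "(\<Sum>x\<in>UNIV. \<phi> (x * (x\<^sup>2 + a * x + b))) = (\<Sum>x\<in>UNIV - {0}. \<phi> (x + b / x + a))"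
    by (intro sum.mono_neutral_cong_right) (auto simp: \<phi>_simps)
  also have "\<dots> = (\<Sum>w\<in>UNIV. \<phi> (w + a) * (1 + \<phi> (w\<^sup>2 - 4 * b)))"
    by (rule sum_over_add_div[OF assms, of "\<lambda>w. \<phi> (w + a)"])
  also have "\<dots> = (\<Sum>w\<in>UNIV. \<phi> (w + a)) + (\<Sum>w\<in>UNIV. \<phi> (w + a) * \<phi> (w\<^sup>2 - 4 * b))"
    by (simp add: algebra_simps sum.distrib)
  also have "(\<Sum>w\<in>UNIV. \<phi> (w + a)) = 0"
    using sum_shift[of \<phi> a] sum_\<phi> by simp
  also have "(\<Sum>w\<in>UNIV. \<phi> (w + a) * \<phi> (w\<^sup>2 - 4 * b)) =
      (\<Sum>w\<in>UNIV. \<phi> ((w + a) * ((w + a)\<^sup>2 - 2 * a * (w + a) + (a\<^sup>2 - 4 * b))))"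
    by (rule sum.cong) (simp_all add: \<phi>_simps(3)[symmetric] power2_eq_square algebra_simps)
  also have "\<dots> = (\<Sum>x\<in>UNIV. \<phi> (x * (x\<^sup>2 - 2 * a * x + (a\<^sup>2 - 4 * b))))"
    by (rule sum_shift[of "\<lambda>x. \<phi> (x * (x\<^sup>2 - 2 * a * x + (a\<^sup>2 - 4 * b)))"])
  finally show ?thesis by simp
qed

section \<open>From Greene's function to a cubic with rational roots\<close>

lemma cube_eq: "\<chi> x ^ 3 = \<chi> (inverse x)"
proof (cases "x = 0")
  case False
  have "\<chi> x * \<chi> x ^ 3 = 1" using power_4[OF False] by (simp add: eval_nat_numeral)
  then show ?thesis using mult_charD(6)[OF mult_char] by (simp add: inverse_unique)
qed (simp add: mult_charD[OF mult_char])

lemma quartic_of_square: "\<chi> (x\<^sup>2) = \<phi> x"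
  by (simp add: mult_charD(4)[OF mult_char] square_eq)

lemma cube_eq_mult: "\<chi> x ^ 3 = \<chi> x * \<phi> x"
  by (simp add: square_eq[symmetric] eval_nat_numeral)

lemma greene_2F1_eq_quartic_sum:
  assumes "x \<noteq> 0" "x \<noteq> 1"
  shows "of_nat CARD('a) * greene_2F1 \<chi> (\<lambda>y. \<chi> y ^ 3) trivial_char x =
    (\<Sum>t\<in>UNIV. \<chi> t * \<phi> ((1 - t)\<^sup>2 + 4 * x * t))"
proof -
  have "of_nat CARD('a) * greene_2F1 \<chi> (\<lambda>y. \<chi> y ^ 3) trivial_char x =
      (\<Sum>y\<in>UNIV. \<chi> y * \<chi> ((1 - y) / (1 - y + x * y)) ^ 3)"
    using greene_2F1_eq_sum[OF mult_char mult_char_pow[OF mult_char, of 3] assms(1)] by simp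
  also have "\<dots> = (\<Sum>y\<in>UNIV. \<chi> (y * (1 - y + x * y) / (1 - y)))"
    by (rule sum.cong) (simp_all only: cube_eq mult_charD(3)[OF mult_char, symmetric] inverse_divide times_divide_eq_right)
  also have "\<dots> = (\<Sum>t\<in>UNIV. \<chi> t * of_nat (card {y. y * (1 - y + x * y) / (1 - y) = t}))"
    using sum_fibre[of UNIV \<chi> "\<lambda>y. y * (1 - y + x * y) / (1 - y)"] by simp
  also have "\<dots> = (\<Sum>t\<in>UNIV. \<chi> t * (1 + \<phi> ((1 - t)\<^sup>2 + 4 * x * t)))"
  proof (rule sum.cong)
    fix t
    show "\<chi> t * of_nat (card {y. y * (1 - y + x * y) / (1 - y) = t}) =
        \<chi> t * (1 + \<phi> ((1 - t)\<^sup>2 + 4 * x * t))"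
    proof (cases "t = 0")
      case False
      \<comment> \<open>The point \<open>y = 1\<close> satisfies neither side: the quotient there is
        0 by convention while \<open>t\<close> is not 0, and the quadratic polynomial takes the
        value \<open>- x\<close>.\<close>
      have "y * (1 - y + x * y) / (1 - y) = t \<longleftrightarrow> (1 - x) * y\<^sup>2 + (- (1 + t)) * y + t = 0" for y
      proof (cases "y = 1")
        case False
        then have "y * (1 - y + x * y) / (1 - y) = t \<longleftrightarrow> y * (1 - y + x * y) = t * (1 - y)"
          by (simp add: divide_eq_eq)
        also have "\<dots> \<longleftrightarrow> (1 - x) * y\<^sup>2 + (- (1 + t)) * y + t = 0"
        proof -
          have "t * (1 - y) - y * (1 - y + x * y) = (1 - x) * y\<^sup>2 + (- (1 + t)) * y + t"
            by (simp add: power2_eq_square algebra_simps)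
          then show ?thesis by (metis eq_iff_diff_eq_0)
        qed
        finally show ?thesis .
      qed (use False \<open>x \<noteq> 0\<close> in simp)
      moreover have "(- (1 + t))\<^sup>2 - 4 * (1 - x) * t = (1 - t)\<^sup>2 + 4 * x * t"
        by (simp add: power2_eq_square algebra_simps)
      ultimately show ?thesis
        using card_quadratic_roots[of "1 - x" "- (1 + t)" t] \<open>x \<noteq> 1\<close> by simp
    qed (simp add: mult_charD[OF mult_char])
  qed simp
  also have "\<dots> = (\<Sum>t\<in>UNIV. \<chi> t) + (\<Sum>t\<in>UNIV. \<chi> t * \<phi> ((1 - t)\<^sup>2 + 4 * x * t))"
    by (simp add: algebra_simps sum.distrib)
  also have "(\<Sum>t\<in>UNIV. \<chi> t) = 0"
  proof -
    have "\<chi> \<noteq> trivial_char"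
    proof
      assume "\<chi> = trivial_char"
      then have "\<forall>x. x \<noteq> 0 \<longrightarrow> \<chi> x ^ 1 = 1" by (simp add: trivial_char_def)
      then have "4 dvd (1::nat)" using char_order_properties(2)[OF mult_char, of 1] order_4 by metis
      then show False by simp
    qed
    then show ?thesis using sum_mult_char[OF mult_char] by simp
  qed
  finally show ?thesis by simp
qed

lemma quartic_sum_eq_cubic_sum:
  "(\<Sum>t\<in>UNIV. \<chi> t * \<phi> ((1 - t)\<^sup>2 + 4 * x * t)) = (\<Sum>w\<in>UNIV. \<phi> (w * (w\<^sup>2 - 4 * w + 4 * x)))"
  (is "?S = _")
proof -
  define D where "D t = \<phi> ((1 - t)\<^sup>2 + 4 * x * t)" for t
  \<comment> \<open>\<open>h\<close> is chosen such that
    \<open>D (v\<^sup>2) = h (v + 1 / v)\<close> for nonzero \<open>v\<close>, because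
    \<open>D\<close> is invariant under inversion.\<close>
  define h where "h w = \<phi> (w\<^sup>2 - 4 + 4 * x)" for w
  have D_inv: "D (inverse t) = D t" if "t \<noteq> 0" for t
  proof -
    have "(1 - inverse t)\<^sup>2 + 4 * x * inverse t = (inverse t)\<^sup>2 * ((1 - t)\<^sup>2 + 4 * x * t)"
      using that by (simp add: field_simps power2_eq_square)
    then show ?thesis using \<phi>_mult_square[of "inverse t"] that by (simp add: D_def)
  qed
  have "?S = (\<Sum>t\<in>UNIV. \<chi> (inverse t) * D (inverse t))"
    unfolding D_def[symmetric]
    by (rule sum.reindex_bij_witness[of _ inverse inverse]) auto
  also have "\<dots> = (\<Sum>t\<in>UNIV. \<chi> t * \<phi> t * D t)"
  proof (rule sum.cong)
    show "\<chi> (inverse t) * D (inverse t) = \<chi> t * \<phi> t * D t" for t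
      using D_inv[of t] cube_eq[of t] cube_eq_mult[of t]
      by (cases "t = 0") (simp_all add: \<phi>_simps mult_charD(1)[OF mult_char])
  qed simp
  \<comment> \<open>Inversion fixes \<open>D\<close> but multiplies \<chi> by \<phi>. Adding the two
    forms of the sum creates the weight \<open>1 + \<phi> t\<close>, which counts square
    roots.\<close>
  finally have "2 * ?S = (\<Sum>t\<in>UNIV. \<chi> t * D t * (1 + \<phi> t))"
    unfolding D_def[symmetric] by (simp add: algebra_simps sum.distrib)
  also have "\<dots> = (\<Sum>v\<in>UNIV. \<phi> v * D (v\<^sup>2))"
    using sum_over_squares[of "\<lambda>t. \<chi> t * D t"]
    by (simp add: mult_charD(1)[OF mult_char] quartic_of_square)
  \<comment> \<open>Since v + 1/v + 2 = ((v + 1)/v)^2 v, the factor \<open>\<phi> v\<close> depends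
    only on v + 1/v, except at \<open>v = -1\<close>: there \<open>\<phi> v\<close> is 1 but the
    replacement is 0, whence the correction \<open>h (-2)\<close>.\<close>
  also have "\<dots> = (\<Sum>v\<in>UNIV - {0}. \<phi> (v + 1 / v + 2) * h (v + 1 / v) + (if v = -1 then h (-2) else 0))"
  proof (rule sum.mono_neutral_cong_right)
    fix v :: 'a assume "v \<in> UNIV - {0}"
    then have v: "v \<noteq> 0" by simp
    have "(1 - v\<^sup>2)\<^sup>2 + 4 * x * v\<^sup>2 = v\<^sup>2 * ((v + 1 / v)\<^sup>2 - 4 + 4 * x)"
      using v by (simp add: field_simps power2_eq_square)
    then have D: "D (v\<^sup>2) = h (v + 1 / v)" using \<phi>_mult_square[OF v] by (simp add: D_def h_def)
    show "\<phi> v * D (v\<^sup>2) = \<phi> (v + 1 / v + 2) * h (v + 1 / v) + (if v = -1 then h (-2) else 0)"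
    proof (cases "v = -1")
      case False
      then have "(v + 1) / v \<noteq> 0" using v by (metis add_eq_0_iff2 divide_eq_0_iff)
      moreover have "v + 1 / v + 2 = ((v + 1) / v)\<^sup>2 * v"
        using v by (simp add: field_simps power2_eq_square)
      ultimately show ?thesis using False by (simp add: \<phi>_mult_square D)
    next
      case True
      then show ?thesis using D by (simp add: \<phi>_simps)
    qed
  qed (auto simp: \<phi>_simps)
  also have "\<dots> = (\<Sum>v\<in>UNIV - {0}. \<phi> (v + 1 / v + 2) * h (v + 1 / v)) + h (-2)"
    by (simp add: sum.distrib)
  also have "(\<Sum>v\<in>UNIV - {0}. \<phi> (v + 1 / v + 2) * h (v + 1 / v)) =
      (\<Sum>w\<in>UNIV. \<phi> (w + 2) * h w * (1 + \<phi> (w\<^sup>2 - 4 * 1)))"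
    using sum_over_add_div[of 1 "\<lambda>w. \<phi> (w + 2) * h w"] by simp
  \<comment> \<open>As w^2 - 4 = (w + 2)(w - 2) and \<open>\<phi> (w + 2)\<close> squares to 1 away
    from \<open>w = -2\<close>, the product splits. The defect at \<open>w = -2\<close> is again
    \<open>h (-2)\<close>, because -4 is a square, and it cancels the earlier correction.\<close>
  also have "\<dots> = (\<Sum>w\<in>UNIV. \<phi> (w + 2) * h w + \<phi> (w - 2) * h w - (if w = -2 then h (-2) else 0))"
  proof (rule sum.cong)
    fix w
    have "\<phi> (w\<^sup>2 - 4 * 1) = \<phi> (w + 2) * \<phi> (w - 2)"
      by (simp add: \<phi>_simps(3)[symmetric] power2_eq_square algebra_simps)
    moreover have "\<phi> (w + 2) * \<phi> (w + 2) = (if w = -2 then 0 else 1)"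
      using \<phi>_square[of "w + 2"] by (auto simp: \<phi>_simps add_eq_0_iff2)
    moreover have "\<phi> (-2 - 2) = 1"
      using \<phi>_minus[of 4] \<phi>_mult_square[OF two_neq_0, of 1] by (simp add: \<phi>_simps)
    ultimately show "\<phi> (w + 2) * h w * (1 + \<phi> (w\<^sup>2 - 4 * 1)) =
        \<phi> (w + 2) * h w + \<phi> (w - 2) * h w - (if w = -2 then h (-2) else 0)"
      by (cases "w = -2") (simp_all add: algebra_simps \<phi>_simps)
  qed simp
  also have "\<dots> + h (-2) = (\<Sum>w\<in>UNIV. \<phi> (w + 2) * h w) + (\<Sum>w\<in>UNIV. \<phi> (w - 2) * h w)"
    by (simp add: sum.distrib sum_subtractf)
  \<comment> \<open>\<open>h\<close> is even and \<open>\<phi> (-1) = 1\<close>, so the two halves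
    agree under w \<mapsto> - w; this cancels the factor 2 in front of \<open>?S\<close>.\<close>
  also have "(\<Sum>w\<in>UNIV. \<phi> (w - 2) * h w) = (\<Sum>w\<in>UNIV. \<phi> (w + 2) * h w)"
  proof (rule sum.reindex_bij_witness[of _ uminus uminus])
    show "\<phi> (- w + 2) * h (- w) = \<phi> (w - 2) * h w" for w
      using \<phi>_minus[of "w - 2"] by (simp add: h_def)
  qed auto
  finally have "?S = (\<Sum>w\<in>UNIV. \<phi> (w + 2) * h w)" by simp
  also have "\<dots> = (\<Sum>w\<in>UNIV. \<phi> ((w + 2) * ((w + 2)\<^sup>2 - 4 * (w + 2) + 4 * x)))"
    by (rule sum.cong) (simp_all add: h_def \<phi>_simps(3)[symmetric] power2_eq_square algebra_simps)
  also have "\<dots> = (\<Sum>w\<in>UNIV. \<phi> (w * (w\<^sup>2 - 4 * w + 4 * x)))"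
    by (rule sum_shift[of "\<lambda>w. \<phi> (w * (w\<^sup>2 - 4 * w + 4 * x))"])
  finally show ?thesis .
qed

text \<open>The argument is given as a fraction so that the isogenous cubic splits over the field
  and its denominators can be cleared; the price is the twist \<open>\<phi> c\<close>. The
  conditions on \<open>z\<close> say that the argument is neither 0 nor 1.\<close>

lemma greene_2F1_eq_legendre_sum:
  assumes "c \<noteq> 0" "z \<noteq> 0" "z \<noteq> c" "z \<noteq> - c"
  shows "of_nat CARD('a) * greene_2F1 \<chi> (\<lambda>y. \<chi> y ^ 3) trivial_char ((z / c)\<^sup>2) =
    \<phi> c * (\<Sum>w\<in>UNIV. \<phi> (w * (w + c - z) * (w + c + z)))"
proof -
  define x where "x = (z / c)\<^sup>2"
  have 4: "(4::'a) \<noteq> 0" using two_neq_0 mult_eq_0_iff[of 2 "2::'a"] by auto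
  have 8: "(8::'a) \<noteq> 0" using 4 two_neq_0 mult_eq_0_iff[of 4 "2::'a"] by auto
  have cx: "c\<^sup>2 * x = z\<^sup>2" using assms by (simp add: x_def power_divide)
  have "z\<^sup>2 \<noteq> c\<^sup>2" using assms by (simp add: power2_eq_iff)
  then have "x \<noteq> 0" "x \<noteq> 1" using assms cx by (auto simp: x_def)
  then have "of_nat CARD('a) * greene_2F1 \<chi> (\<lambda>y. \<chi> y ^ 3) trivial_char x =
      (\<Sum>w\<in>UNIV. \<phi> (w * (w\<^sup>2 + (- 4) * w + 4 * x)))"
    by (simp add: greene_2F1_eq_quartic_sum quartic_sum_eq_cubic_sum)
  also have "\<dots> = (\<Sum>w\<in>UNIV. \<phi> (w * (w\<^sup>2 - 2 * (- 4) * w + ((- 4)\<^sup>2 - 4 * (4 * x)))))"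
    using \<open>x \<noteq> 0\<close> 4 by (intro sum_\<phi>_isogeny) simp
  \<comment> \<open>The quadratic factor is now w^2 + 8 w + 16 (1 - x), with roots -(4/c)(c - z) and
    -(4/c)(c + z). Scaling by 4/c moves them to -(c - z) and -(c + z).\<close>
  also have "\<dots> = (\<Sum>w\<in>UNIV. \<phi> (4 / c * w * ((4 / c * w)\<^sup>2 - 2 * (- 4) * (4 / c * w) + ((- 4)\<^sup>2 - 4 * (4 * x)))))"
    using 4 assms(1)
    by (intro sum_scale[symmetric, where f = "\<lambda>w. \<phi> (w * (w\<^sup>2 - 2 * (- 4) * w + ((- 4)\<^sup>2 - 4 * (4 * x))))"]) simp
  also have "\<dots> = (\<Sum>w\<in>UNIV. \<phi> c * \<phi> (w * (w + c - z) * (w + c + z)))"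
  proof (rule sum.cong)
    fix w
    have "c ^ 4 * (4 / c * w * ((4 / c * w)\<^sup>2 - 2 * (- 4) * (4 / c * w) + ((- 4)\<^sup>2 - 4 * (4 * x)))) =
        64 * c * w * (w\<^sup>2 + 2 * c * w + c\<^sup>2 - c\<^sup>2 * x)"
      using assms(1) by (simp add: field_simps eval_nat_numeral)
    also have "\<dots> = 8\<^sup>2 * (c * (w * (w + c - z) * (w + c + z)))"
      unfolding cx by (simp add: power2_eq_square algebra_simps)
    finally have "4 / c * w * ((4 / c * w)\<^sup>2 - 2 * (- 4) * (4 / c * w) + ((- 4)\<^sup>2 - 4 * (4 * x))) =
        (8 / c\<^sup>2)\<^sup>2 * (c * (w * (w + c - z) * (w + c + z)))"
      using assms(1) by (simp add: field_simps eval_nat_numeral)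
    then show "\<phi> (4 / c * w * ((4 / c * w)\<^sup>2 - 2 * (- 4) * (4 / c * w) + ((- 4)\<^sup>2 - 4 * (4 * x)))) =
        \<phi> c * \<phi> (w * (w + c - z) * (w + c + z))"
      using \<phi>_mult_square[of "8 / c\<^sup>2"] 8 assms(1) by (simp add: \<phi>_simps(3))
  qed simp
  finally show ?thesis by (simp add: x_def sum_distrib_left)
qed

lemma two_power_neq_0: "(2::'a) ^ n \<noteq> 0"
  using two_neq_0 by simp

subsection \<open>The special values\<close>

text \<open>The cube of \<chi> is \<chi> times \<phi>, so the two Jacobi sums combine with weight
  \<open>1 + \<phi> t\<close>. Only squares t = v^2 remain, where \<chi> becomes
  \<open>\<phi> v\<close>.\<close>

lemma char_binomial_quartic:
  "char_binomial \<chi> \<phi> + char_binomial (\<lambda>x. \<chi> x ^ 3) \<phi> =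
    (\<Sum>v\<in>UNIV. \<phi> (v ^ 3 - v)) / of_nat CARD('a)"
proof -
  have cnj: "cnj (\<phi> x) = \<phi> x" for x by (simp add: quadratic_char_def)
  have "char_binomial \<chi> \<phi> + char_binomial (\<lambda>x. \<chi> x ^ 3) \<phi> =
      (\<Sum>t\<in>UNIV. \<chi> t * \<phi> (1 - t) * (1 + \<phi> t)) / of_nat CARD('a)"
    by (simp add: char_binomial_def cnj cube_eq_mult algebra_simps sum.distrib add_divide_distrib)
  also have "(\<Sum>t\<in>UNIV. \<chi> t * \<phi> (1 - t) * (1 + \<phi> t)) = (\<Sum>v\<in>UNIV. \<phi> v * \<phi> (1 - v\<^sup>2))"
    using sum_over_squares[of "\<lambda>t. \<chi> t * \<phi> (1 - t)"]
    by (simp add: mult_charD(1)[OF mult_char] quartic_of_square)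
  also have "\<dots> = (\<Sum>v\<in>UNIV. \<phi> (v ^ 3 - v))"
  proof (rule sum.cong)
    show "\<phi> v * \<phi> (1 - v\<^sup>2) = \<phi> (v ^ 3 - v)" for v
      using \<phi>_minus[of "v ^ 3 - v"]
      by (simp add: \<phi>_simps(3)[symmetric] eval_nat_numeral algebra_simps)
  qed simp
  finally show ?thesis .
qed

text \<open>Together with 1, the two cubic characters count cube roots, and the extra term 1 costs
  nothing since \<phi> sums to 0. Conjugation merely exchanges \<psi> and its square.\<close>

lemma char_binomial_cubic:
  assumes \<psi>: "mult_char \<psi>" "char_order \<psi> = 3"
  shows "char_binomial \<phi> \<psi> + char_binomial \<phi> (\<lambda>x. \<psi> x ^ 2) =
    (\<Sum>v\<in>UNIV. \<phi> (v ^ 3 - 1)) / of_nat CARD('a)"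
proof -
  have p3: "\<psi> t ^ 3 = 1" if "t \<noteq> 0" for t
    using power_char_order[OF \<psi>(1) that] \<psi>(2) by simp
  have m1: "\<psi> (-1) = 1"
  proof -
    have "\<psi> (-1) ^ 2 = 1" using mult_charD(2,4)[OF \<psi>(1)] by (metis power2_minus power_one)
    then show ?thesis using p3[of "-1"] by (simp add: eval_nat_numeral)
  qed
  have cnj: "cnj (\<psi> t) = \<psi> t ^ 2" for t
  proof (cases "t = 0")
    case False
    have "\<psi> t * \<psi> t ^ 2 = 1" using p3[OF False] by (simp add: eval_nat_numeral)
    then show ?thesis
      unfolding cnj_mult_char[OF \<psi>(1)] mult_charD(6)[OF \<psi>(1)] by (rule inverse_unique)
  qed (simp add: mult_charD(1)[OF \<psi>(1)])
  have cnj2: "cnj (\<psi> t ^ 2) = \<psi> t" for t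
    using cnj[of t] by (metis complex_cnj_cnj)
  have "char_binomial \<phi> \<psi> + char_binomial \<phi> (\<lambda>x. \<psi> x ^ 2) =
      (\<Sum>y\<in>UNIV. \<phi> y * (\<psi> (1 - y) + \<psi> (1 - y) ^ 2)) / of_nat CARD('a)"
    unfolding char_binomial_def cnj cnj2
    by (simp add: m1 algebra_simps sum.distrib add_divide_distrib)
  also have "(\<Sum>y\<in>UNIV. \<phi> y * (\<psi> (1 - y) + \<psi> (1 - y) ^ 2)) =
      (\<Sum>t\<in>UNIV. \<phi> (t - 1) * (\<psi> t + \<psi> t ^ 2))"
  proof (rule sum.reindex_bij_witness[of _ "\<lambda>t. 1 - t" "\<lambda>y. 1 - y"])
    show "\<phi> (1 - y - 1) * (\<psi> (1 - y) + \<psi> (1 - y) ^ 2) = \<phi> y * (\<psi> (1 - y) + \<psi> (1 - y) ^ 2)" for y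
      using \<phi>_minus[of y] by simp
  qed auto
  also have "\<dots> = (\<Sum>v\<in>UNIV. \<phi> (v ^ 3 - 1))"
  proof -
    \<comment> \<open>\<open>sum_over_powers\<close> wants a function vanishing at 0, so the value
      \<open>\<phi> (-1) = 1\<close> at \<open>v = 0\<close> is split off and restored at
      \<open>t = 0\<close> afterwards.\<close>
    have "\<phi> (v ^ 3 - 1) = (if v ^ 3 = 0 then 0 else \<phi> (v ^ 3 - 1)) + (if v = 0 then 1 else 0)" for v
      by auto
    then have "(\<Sum>v\<in>UNIV. \<phi> (v ^ 3 - 1)) =
        (\<Sum>v\<in>UNIV. (if v ^ 3 = 0 then 0 else \<phi> (v ^ 3 - 1)) + (if v = 0 then 1 else 0))"
      by (intro sum.cong) auto
    also have "\<dots> = (\<Sum>v::'a\<in>UNIV. if v ^ 3 = 0 then 0 else \<phi> (v ^ 3 - 1)) + 1"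
      by (simp add: sum.distrib)
    also have "(\<Sum>v::'a\<in>UNIV. if v ^ 3 = 0 then 0 else \<phi> (v ^ 3 - 1)) =
        (\<Sum>t\<in>UNIV. (if t = 0 then 0 else \<phi> (t - 1)) * (\<Sum>k<3. \<psi> t ^ k))"
      by (rule sum_over_powers[OF \<psi>]) simp
    also have "\<dots> + 1 = (\<Sum>t\<in>UNIV. (if t = 0 then 0 else \<phi> (t - 1)) * (\<Sum>k<3. \<psi> t ^ k) + (if t = 0 then 1 else 0))"
      by (simp add: sum.distrib)
    also have "\<dots> = (\<Sum>t\<in>UNIV. \<phi> (t - 1) + \<phi> (t - 1) * (\<psi> t + \<psi> t ^ 2))"
      by (rule sum.cong)
        (auto simp: eval_nat_numeral algebra_simps mult_charD(1)[OF \<psi>(1)])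
    also have "\<dots> = (\<Sum>t\<in>UNIV. \<phi> (t - 1) * (\<psi> t + \<psi> t ^ 2))"
      using sum_shift[of \<phi> "- 1"] sum_\<phi> by (simp add: sum.distrib)
    finally show ?thesis by simp
  qed
  finally show ?thesis .
qed

lemma greene_2F1_sqrt2:
  assumes s: "s\<^sup>2 = 2"
  shows "greene_2F1 \<chi> (\<lambda>y. \<chi> y ^ 3) trivial_char (((- 2 * s + 3) / (6 * s + 3))\<^sup>2) =
    \<phi> (6 + 12 * s) * (char_binomial \<chi> \<phi> + char_binomial (\<lambda>x. \<chi> x ^ 3) \<phi>)"
proof -
  have ss: "s * s = 2" using s by (simp add: power2_eq_square)
  have "s \<noteq> 0" using ss two_neq_0 by auto
  have pow: "(4::'a) \<noteq> 0" "(8::'a) \<noteq> 0" "(16::'a) \<noteq> 0"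
    using two_power_neq_0[of 2] two_power_neq_0[of 3] two_power_neq_0[of 4] by simp_all
  define c where "c = 6 * s + 3"
  define z where "z = - 2 * s + 3"
  have cc: "\<phi> (6 + 12 * s) = \<phi> c"
  proof -
    have "6 + 12 * s = s\<^sup>2 * c" by (simp add: s c_def)
    then show ?thesis using \<phi>_mult_square[OF \<open>s \<noteq> 0\<close>] by simp
  qed
  show ?thesis
  proof (cases "c = 0")
    case True
    \<comment> \<open>The argument is then the junk value of a division by 0 and both sides vanish.\<close>
    then show ?thesis
      unfolding cc unfolding c_def[symmetric] by (simp add: greene_2F1_def \<phi>_simps mult_charD)
  next
    case False
    \<comment> \<open>Multiplication by a conjugate, here and for \<open>4 * s + 6\<close> below,
      yields 1 and -4; hence neither factor vanishes in odd characteristic.\<close>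
    have "z * (2 * s + 3) = 9 - 4 * (s * s)" by (simp add: z_def algebra_simps)
    then have "z * (2 * s + 3) = 1" by (simp add: ss)
    then have "z \<noteq> 0" by auto
    have "c - z = 8 * s" "c + z = 4 * s + 6" by (simp_all add: c_def z_def)
    moreover have "(4 * s + 6) * (4 * s - 6) = 16 * (s * s) - 36" by (simp add: algebra_simps)
    then have "(4 * s + 6) * (4 * s - 6) = - 4" by (simp add: ss)
    then have "4 * s + 6 \<noteq> 0" using pow by auto
    ultimately have ne: "z \<noteq> c" "z \<noteq> - c" using \<open>s \<noteq> 0\<close> pow by (auto simp: eq_neg_iff_add_eq_0 add.commute)
    \<comment> \<open>The root -(c + z) is moved to the origin. The other two become 6 + 4 s and 6 -
      4 s, with sum 12 and product 4, so that \<open>s\<close> disappears from the cubic.\<close>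
    have "(\<Sum>w\<in>UNIV. \<phi> (w * (w + c - z) * (w + c + z))) =
        (\<Sum>u\<in>UNIV. \<phi> (u * (u\<^sup>2 + (- 12) * u + 4)))"
    proof -
      have "w * (w + c - z) * (w + c + z) =
          (w + (4 * s + 6)) * ((w + (4 * s + 6))\<^sup>2 + (- 12) * (w + (4 * s + 6)) + (36 - 16 * s\<^sup>2))" for w
        by (simp add: c_def z_def power2_eq_square algebra_simps)
      then show ?thesis
        using sum_shift[of "\<lambda>u. \<phi> (u * (u\<^sup>2 + (- 12) * u + 4))" "4 * s + 6"]
        by (simp add: s)
    qed
    also have "\<dots> = (\<Sum>u\<in>UNIV. \<phi> (u * (u\<^sup>2 - 2 * (- 12) * u + ((- 12)\<^sup>2 - 4 * 4))))"
      by (rule sum_\<phi>_isogeny) (use pow in simp)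
    \<comment> \<open>The isogenous cubic is u (u + 8)(u + 16). Centring its equally spaced roots at
      0 gives u^3 - 64 u.\<close>
    also have "\<dots> = (\<Sum>u\<in>UNIV. \<phi> (u ^ 3 - 64 * u))"
    proof -
      have "u ^ 3 - 64 * u = (u + (- 8)) * ((u + (- 8))\<^sup>2 - 2 * (- 12) * (u + (- 8)) + ((- 12)\<^sup>2 - 4 * 4))" for u :: 'a
        by (simp add: eval_nat_numeral algebra_simps)
      then show ?thesis
        using sum_shift[of "\<lambda>u. \<phi> (u * (u\<^sup>2 - 2 * (- 12) * u + ((- 12)\<^sup>2 - 4 * 4)))" "- 8"] by simp
    qed
    also have "\<dots> = (\<Sum>v\<in>UNIV. \<phi> ((8 * v) ^ 3 - 64 * (8 * v)))"
      by (rule sum_scale[symmetric, where f = "\<lambda>u. \<phi> (u ^ 3 - 64 * u)"]) (use pow in simp)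
    also have "\<dots> = (\<Sum>v\<in>UNIV. \<phi> (v ^ 3 - v))"
    proof (rule sum.cong)
      fix v
      \<comment> \<open>The twisting factor 8^3 = 512 is twice a square, and 2 is the square of
        \<open>s\<close>.\<close>
      have "(8 * v) ^ 3 - 64 * (8 * v) = (16 * s)\<^sup>2 * (v ^ 3 - v)"
        by (simp add: power_mult_distrib s algebra_simps)
      then show "\<phi> ((8 * v) ^ 3 - 64 * (8 * v)) = \<phi> (v ^ 3 - v)"
        using \<phi>_mult_square[of "16 * s"] pow \<open>s \<noteq> 0\<close> by simp
    qed simp
    finally have "of_nat CARD('a) * greene_2F1 \<chi> (\<lambda>y. \<chi> y ^ 3) trivial_char ((z / c)\<^sup>2) =
        \<phi> c * (\<Sum>v\<in>UNIV. \<phi> (v ^ 3 - v))"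
      using greene_2F1_eq_legendre_sum[OF False \<open>z \<noteq> 0\<close> ne] by simp
    then show ?thesis
      unfolding cc char_binomial_quartic c_def[symmetric] z_def[symmetric]
      by (simp add: field_simps)
  qed
qed

lemma greene_2F1_sqrt3:
  assumes s: "s\<^sup>2 = 3" and "(3::'a) \<noteq> 0" and \<psi>: "mult_char \<psi>" "char_order \<psi> = 3"
  shows "greene_2F1 \<chi> (\<lambda>y. \<chi> y ^ 3) trivial_char (((- 2 + s) / (6 + s))\<^sup>2) =
    \<phi> ((8 + 5 * s) / (12 + 6 * s)) *
      (char_binomial \<phi> \<psi> + char_binomial \<phi> (\<lambda>x. \<psi> x ^ 2))"
proof -
  have ss: "s * s = 3" using s by (simp add: power2_eq_square)
  have "s \<noteq> 0" using ss assms(2) by auto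
  have pow: "(4::'a) \<noteq> 0" "(8::'a) \<noteq> 0"
    using two_power_neq_0[of 2] two_power_neq_0[of 3] by simp_all
  have "(6::'a) = 2 * 3" by simp
  then have 6: "(6::'a) \<noteq> 0" using two_neq_0 assms(2) by (metis mult_eq_0_iff)
  define c where "c = 6 + s"
  define z where "z = - 2 + s"
  have "(2 + s) * (2 - s) = 4 - s * s" by (simp add: algebra_simps)
  then have "(2 + s) * (2 - s) = 1" by (simp add: ss)
  then have "2 + s \<noteq> 0" by auto
  \<comment> \<open>The factor (8 / s)^3 is the twist produced by the rescaling below. The stated
    quotient equals c (8 / s)^3 up to the square of 1/32.\<close>
  have cc: "\<phi> ((8 + 5 * s) / (12 + 6 * s)) = \<phi> c * \<phi> ((8 / s) ^ 3)"
  proof -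
    have "12 + 6 * s = 6 * (2 + s)" by simp
    then have "12 + 6 * s \<noteq> 0" using 6 \<open>2 + s \<noteq> 0\<close> by (metis mult_eq_0_iff)
    moreover have "(8 + 5 * s) * (32\<^sup>2 * s ^ 3) = 8 ^ 3 * c * (12 + 6 * s)"
    proof -
      have "s ^ 3 = 3 * s" by (simp add: power3_eq_cube ss)
      then have "(8 + 5 * s) * (32\<^sup>2 * s ^ 3) = 24576 * s + 15360 * (s * s)"
        by (simp add: algebra_simps)
      moreover have "8 ^ 3 * c * (12 + 6 * s) = 36864 + 24576 * s + 3072 * (s * s)"
        by (simp add: c_def algebra_simps)
      ultimately show ?thesis by (simp add: ss)
    qed
    moreover have 32: "(32::'a) \<noteq> 0" using two_power_neq_0[of 5] by simp
    then have "32\<^sup>2 * s ^ 3 \<noteq> 0" using \<open>s \<noteq> 0\<close> by (metis mult_eq_0_iff power_not_zero)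
    ultimately have "(8 + 5 * s) / (12 + 6 * s) = 8 ^ 3 * c / (32\<^sup>2 * s ^ 3)"
      by (metis frac_eq_eq)
    also have "\<dots> = (1 / 32)\<^sup>2 * (c * (8 / s) ^ 3)"
      by (simp add: power_divide)
    finally show ?thesis
      using \<phi>_mult_square[of "1 / 32"] 32 by (simp add: \<phi>_simps(3))
  qed
  show ?thesis
  proof (cases "c = 0")
    case True
    \<comment> \<open>The argument is then the junk value of a division by 0 and both sides vanish.\<close>
    then show ?thesis
      unfolding cc unfolding c_def[symmetric] by (simp add: greene_2F1_def \<phi>_simps mult_charD)
  next
    case False
    have "z * (2 + s) = s * s - 4" by (simp add: z_def algebra_simps)
    then have "z * (2 + s) = - 1" by (simp add: ss)
    then have "z \<noteq> 0" by auto
    have "c - z = 8" "c + z = 2 * (2 + s)" by (simp_all add: c_def z_def)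
    then have "c - z \<noteq> 0" "c + z \<noteq> 0"
      using pow \<open>2 + s \<noteq> 0\<close> two_neq_0 by (metis mult_eq_0_iff)+
    then have ne: "z \<noteq> c" "z \<noteq> - c" by auto
    \<comment> \<open>Again the root -(c + z) goes to the origin; the other two become 2 s + 4 and 2
      s - 4, with sum 4 s and product -4.\<close>
    have "(\<Sum>w\<in>UNIV. \<phi> (w * (w + c - z) * (w + c + z))) =
        (\<Sum>u\<in>UNIV. \<phi> (u * (u\<^sup>2 + (- 4 * s) * u + (- 4))))"
    proof -
      have "w * (w + c - z) * (w + c + z) =
          (w + (4 + 2 * s)) * ((w + (4 + 2 * s))\<^sup>2 + (- 4 * s) * (w + (4 + 2 * s)) + (4 * s\<^sup>2 - 16))" for w
        by (simp add: c_def z_def power2_eq_square algebra_simps)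
      then show ?thesis
        using sum_shift[of "\<lambda>u. \<phi> (u * (u\<^sup>2 + (- 4 * s) * u + (- 4)))" "4 + 2 * s"]
        by (simp add: s)
    qed
    also have "\<dots> = (\<Sum>u\<in>UNIV. \<phi> (u * (u\<^sup>2 - 2 * (- 4 * s) * u + ((- 4 * s)\<^sup>2 - 4 * (- 4)))))"
      by (rule sum_\<phi>_isogeny) (use pow in simp)
    also have "\<dots> = (\<Sum>u\<in>UNIV. \<phi> (u * (u\<^sup>2 + 8 * s * u + 64)))"
      using s by (simp add: power_mult_distrib)
    \<comment> \<open>The scale 8/s turns u^2 + 8 s u + 64 into a multiple of v^2 + 3 v + 3, and v
      (v^2 + 3 v + 3) = (v + 1)^3 - 1.\<close>
    also have "\<dots> = (\<Sum>v\<in>UNIV. \<phi> (8 / s * v * ((8 / s * v)\<^sup>2 + 8 * s * (8 / s * v) + 64)))"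
      by (rule sum_scale[symmetric, where f = "\<lambda>u. \<phi> (u * (u\<^sup>2 + 8 * s * u + 64))"])
        (use pow \<open>s \<noteq> 0\<close> in simp)
    also have "\<dots> = (\<Sum>v\<in>UNIV. \<phi> ((8 / s) ^ 3 * ((v + 1) ^ 3 - 1)))"
    proof (rule sum.cong)
      fix v
      have "(8 / s) ^ 3 * ((v + 1) ^ 3 - 1) = (8 / s) ^ 3 * (v * (v\<^sup>2 + s\<^sup>2 * v + s\<^sup>2))"
        unfolding s by (simp add: eval_nat_numeral algebra_simps)
      also have "\<dots> = 8 / s * v * ((8 / s * v)\<^sup>2 + 8 * s * (8 / s * v) + 64)"
        using \<open>s \<noteq> 0\<close> by (simp add: field_simps eval_nat_numeral)
      finally show "\<phi> (8 / s * v * ((8 / s * v)\<^sup>2 + 8 * s * (8 / s * v) + 64)) =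
          \<phi> ((8 / s) ^ 3 * ((v + 1) ^ 3 - 1))" by simp
    qed simp
    also have "\<dots> = (\<Sum>v\<in>UNIV. \<phi> ((8 / s) ^ 3 * (v ^ 3 - 1)))"
      by (rule sum_shift[of "\<lambda>v. \<phi> ((8 / s) ^ 3 * (v ^ 3 - 1))"])
    also have "\<dots> = \<phi> ((8 / s) ^ 3) * (\<Sum>v\<in>UNIV. \<phi> (v ^ 3 - 1))"
      unfolding \<phi>_simps(3) sum_distrib_left ..
    finally have "of_nat CARD('a) * greene_2F1 \<chi> (\<lambda>y. \<chi> y ^ 3) trivial_char ((z / c)\<^sup>2) =
        \<phi> c * \<phi> ((8 / s) ^ 3) * (\<Sum>v\<in>UNIV. \<phi> (v ^ 3 - 1))"
      using greene_2F1_eq_legendre_sum[OF False \<open>z \<noteq> 0\<close> ne] by (simp add: mult.assoc)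
    then show ?thesis
      unfolding cc char_binomial_cubic[OF \<psi>] c_def[symmetric] z_def[symmetric]
      by (simp add: field_simps)
  qed
qed

end

theorem theorem1p8:
  fixes p r :: nat
  assumes "prime p" and "odd p" and "CARD('a::{field,finite}) = p ^ r"
  shows
    "([CARD('a) = 1] (mod 8) \<longrightarrow>
       (\<forall>(\<chi>\<^sub>4 :: 'a \<Rightarrow> complex) (s :: 'a).
          mult_char \<chi>\<^sub>4 \<and> char_order \<chi>\<^sub>4 = 4 \<and> s\<^sup>2 = 2 \<longrightarrow>
          (\<forall>\<sigma> \<in> {1, - 1}.
             greene_2F1 \<chi>\<^sub>4 (\<lambda>x. \<chi>\<^sub>4 x ^ 3) trivial_char
               (((- 2 * s + \<sigma> * 3) / (6 * s + \<sigma> * 3))\<^sup>2)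
             = quadratic_char (6 + \<sigma> * 12 * s) *
               (char_binomial \<chi>\<^sub>4 quadratic_char
                + char_binomial (\<lambda>x. \<chi>\<^sub>4 x ^ 3) quadratic_char))))
     \<and>
     ([CARD('a) = 1] (mod 12) \<longrightarrow>
       (\<forall>(\<chi>\<^sub>4 :: 'a \<Rightarrow> complex) (\<chi>\<^sub>3 :: 'a \<Rightarrow> complex) (s :: 'a).
          mult_char \<chi>\<^sub>4 \<and> char_order \<chi>\<^sub>4 = 4 \<and>
          mult_char \<chi>\<^sub>3 \<and> char_order \<chi>\<^sub>3 = 3 \<and> s\<^sup>2 = 3 \<longrightarrow>
          (\<forall>\<sigma> \<in> {1, - 1}.
             greene_2F1 \<chi>\<^sub>4 (\<lambda>x. \<chi>\<^sub>4 x ^ 3) trivial_char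
               (((- 2 + \<sigma> * s) / (6 + \<sigma> * s))\<^sup>2)
             = quadratic_char ((8 + \<sigma> * 5 * s) / (12 + \<sigma> * 6 * s)) *
               (char_binomial quadratic_char \<chi>\<^sub>3
                + char_binomial quadratic_char (\<lambda>x. \<chi>\<^sub>3 x ^ 2)))))"
proof (intro conjI impI allI ballI)
  fix \<chi>\<^sub>4 :: "'a \<Rightarrow> complex" and s \<sigma> :: 'a
  assume asm: "mult_char \<chi>\<^sub>4 \<and> char_order \<chi>\<^sub>4 = 4 \<and> s\<^sup>2 = 2" and \<sigma>: "\<sigma> \<in> {1, - 1}"
  interpret quartic_char \<chi>\<^sub>4 using asm by unfold_locales auto
  \<comment> \<open>Multiplying numerator and denominator by \<sigma> moves the sign onto the square
    root, so both signs are instances of one lemma applied to \<open>\<sigma> * s\<close>.\<close>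
  have "(- 2 * s + \<sigma> * 3) / (6 * s + \<sigma> * 3) = (- 2 * (\<sigma> * s) + 3) / (6 * (\<sigma> * s) + 3)"
    using \<sigma> minus_divide_divide[of "- 2 * s - 3" "6 * s - 3"] by auto
  moreover have "(\<sigma> * s)\<^sup>2 = 2" using asm \<sigma> by (auto simp: power_mult_distrib)
  ultimately show "greene_2F1 \<chi>\<^sub>4 (\<lambda>x. \<chi>\<^sub>4 x ^ 3) trivial_char
        (((- 2 * s + \<sigma> * 3) / (6 * s + \<sigma> * 3))\<^sup>2)
      = quadratic_char (6 + \<sigma> * 12 * s) *
        (char_binomial \<chi>\<^sub>4 quadratic_char + char_binomial (\<lambda>x. \<chi>\<^sub>4 x ^ 3) quadratic_char)"
    using greene_2F1_sqrt2[of "\<sigma> * s"] by (simp add: mult_ac)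
next
  fix \<chi>\<^sub>4 \<chi>\<^sub>3 :: "'a \<Rightarrow> complex" and s \<sigma> :: 'a
  assume asm: "mult_char \<chi>\<^sub>4 \<and> char_order \<chi>\<^sub>4 = 4 \<and>
      mult_char \<chi>\<^sub>3 \<and> char_order \<chi>\<^sub>3 = 3 \<and> s\<^sup>2 = 3" and \<sigma>: "\<sigma> \<in> {1, - 1}"
  interpret quartic_char \<chi>\<^sub>4 using asm by unfold_locales auto
  \<comment> \<open>A character of order 3 makes \<open>CARD('a)\<close> congruent to 1 modulo 3,
    which excludes characteristic 3.\<close>
  have "(3::'a) \<noteq> 0"
  proof
    assume 3: "(3::'a) = 0"
    have "3 dvd CARD('a) - 1" using char_order_dvd_card[of \<chi>\<^sub>3] asm by simp
    then obtain m where "CARD('a) = 3 * m + 1"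
      using card_field_gt_1[where 'a='a] by (metis dvdE le_add_diff_inverse2 less_imp_le)
    then show False using of_nat_CARD[where 'a='a] 3 by simp
  qed
  moreover have "(\<sigma> * s)\<^sup>2 = 3" using asm \<sigma> by (auto simp: power_mult_distrib)
  ultimately show "greene_2F1 \<chi>\<^sub>4 (\<lambda>x. \<chi>\<^sub>4 x ^ 3) trivial_char
        (((- 2 + \<sigma> * s) / (6 + \<sigma> * s))\<^sup>2)
      = quadratic_char ((8 + \<sigma> * 5 * s) / (12 + \<sigma> * 6 * s)) *
        (char_binomial quadratic_char \<chi>\<^sub>3 + char_binomial quadratic_char (\<lambda>x. \<chi>\<^sub>3 x ^ 2))"
    using greene_2F1_sqrt3[of "\<sigma> * s" \<chi>\<^sub>3] asm by (simp add: mult_ac)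
qed

end
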